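(* Let $X=[\ell,u]\subseteq\mathbb{R}^n$ be a box with $\ell_i<u_i$ for all $i$, let $g:\mathbb{R}^n\to\mathbb{R}$ be a convex function and $\epsilon>0$. When Algorithm 2 (defined in the context) stops, it returns an $\epsilon$-polyhedral underestimator of $g$ on $X$; that is, the returned function $g^k$ is polyhedral convex and satisfies $0\le g(x)-g^k(x)\le\epsilon$ for all $x\in X$.
   Context: $X=\{x\in\mathbb{R}^n\mid \ell_i\le x_i\le u_i,\ i=1,\dots,n\}$ with $\ell_i<u_i$ for all $i$. A function is polyhedral convex if its epigraph is a polyhedral convex set. A polyhedral convex $\bar g:\mathbb{R}^n\to\mathbb{R}$ is an $\epsilon$-polyhedral underestimator of $g$ on $X$ if $0\le g(x)-\bar g(x)\le\epsilon$ for all $x\in X$. For $x\in\mathbb{R}^n$, $c(x)$ denotes an (arbitrary, chosen) element of the subdifferential $\partial g(x)$, and for $x^*\in\mathbb{R}^n$, $$H(g,x^* )=\{(x,t)\in\mathbb{R}^n\times\mathbb{R}\mid t-c(x^* )^{\mathsf T}x\ge g(x^* )-c(x^* )^{\mathsf T}x^*\}.$$ $\operatorname{vert} C$ denotes the set of vertices of a polyhedral convex set $C$. Algorithm 2 (input $g$, $X=[\ell,u]$, $\epsilon$): Set $\mathcal V=\emptyset$, $k=0$, $R=\emptyset$, $x^0=\frac{\ell+u}{2}$, $C^0=H(g,x^0)\cap(X\times\mathbb{R})$, $g^0(x)=g(x^0)+c(x^0)^{\mathsf T}(x-x^0)$. While $R\ne\mathbb{R}^{n+1}$, do: compute $\operatorname{vert}C^k$;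 set $R=\mathbb{R}^{n+1}$, $j=0$, $g^{k,0}=g^k$; for every $(\bar x,\bar y)\in\operatorname{vert}C^k\setminus\mathcal V$: if $g(\bar x)-\bar y>\epsilon$, replace $R$ by $R\cap H(g,\bar x)$, set $g^{k,j+1}(x)=\max\{g^{k,j}(x),\,g(\bar x)+c(\bar x)^{\mathsf T}(x-\bar x)\}$ and increase $j$ by $1$; otherwise add $(\bar x,\bar y)$ to $\mathcal V$. After all these vertices have been treated, set $C^{k+1}=C^k\cap R$, $g^{k+1}=g^{k,j}$, and increase $k$ by $1$. When the while loop ends (i.e. a pass finished with $R=\mathbb{R}^{n+1}$), return $g^k$ (and $\operatorname{vert}C^k$). *)

theory Defs
  imports "HOL-Analysis.Analysis"
begin

definition subdifferential :: "(real^'n \<Rightarrow> real) \<Rightarrow> real^'n \<Rightarrow> (real^'n) set"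
  where "subdifferential g x = {c. \<forall>y. g y \<ge> g x + c \<bullet> (y - x)}"

definition polyhedral_convex_fun :: "(real^'n \<Rightarrow> real) \<Rightarrow> bool"
  where "polyhedral_convex_fun h \<longleftrightarrow> polyhedron (epigraph UNIV h)"

definition polyhedral_underestimator ::
    "real \<Rightarrow> (real^'n) set \<Rightarrow> (real^'n \<Rightarrow> real) \<Rightarrow> (real^'n \<Rightarrow> real) \<Rightarrow> bool"
  where "polyhedral_underestimator \<epsilon> X g h \<longleftrightarrow>
    polyhedral_convex_fun h \<and> (\<forall>x\<in>X. 0 \<le> g x - h x \<and> g x - h x \<le> \<epsilon>)"

definition vert :: "'a::euclidean_space set \<Rightarrow> 'a set"
  where "vert C = {v. v extreme_point_of C}"

text \<open>The function \<open>c\<close> is the selection of subgradients: \<open>c x\<close> is the chosen element of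
  the subdifferential of \<open>g\<close> at \<open>x\<close>.\<close>

definition halfspace_at ::
    "(real^'n \<Rightarrow> real) \<Rightarrow> (real^'n \<Rightarrow> real^'n) \<Rightarrow> real^'n \<Rightarrow> ((real^'n) \<times> real) set"
  where "halfspace_at g c z = {(x, t). t - c z \<bullet> x \<ge> g z - c z \<bullet> z}"

definition affine_minorant ::
    "(real^'n \<Rightarrow> real) \<Rightarrow> (real^'n \<Rightarrow> real^'n) \<Rightarrow> real^'n \<Rightarrow> real^'n \<Rightarrow> real"
  where "affine_minorant g c z = (\<lambda>x. g z + c z \<bullet> (x - z))"

text \<open>The program variables: \<open>done_verts\<close> is the set \<open>\<V>\<close>, \<open>cuts\<close> is \<open>R\<close>, \<open>outer\<close> is
  the current \<open>C\<^sup>k\<close>, and \<open>under\<close> is the current \<open>g\<^sup>k\<close>, or \<open>g\<^sup>k\<^sup>,\<^sup>j\<close> inside the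
  for loop.  The inner counter \<open>j\<close> is never read and is left out.\<close>

record ('n::finite) alg_state =
  done_verts :: "((real^'n) \<times> real) set"
  cuts :: "((real^'n) \<times> real) set"
  outer :: "((real^'n) \<times> real) set"
  under :: "real^'n \<Rightarrow> real"

definition init_state ::
    "(real^'n \<Rightarrow> real) \<Rightarrow> (real^'n \<Rightarrow> real^'n) \<Rightarrow> real^'n \<Rightarrow> real^'n \<Rightarrow> 'n alg_state"
  where "init_state g c l u =
    \<lparr>done_verts = {}, cuts = {},
     outer = halfspace_at g c (midpoint l u) \<inter> (cbox l u \<times> UNIV),
     under = affine_minorant g c (midpoint l u)\<rparr>"

definition treat_vertex ::
    "(real^'n \<Rightarrow> real) \<Rightarrow> (real^'n \<Rightarrow> real^'n) \<Rightarrow> real \<Rightarrow>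
      (real^'n) \<times> real \<Rightarrow> 'n alg_state \<Rightarrow> 'n alg_state"
  where "treat_vertex g c \<epsilon> = (\<lambda>(x, y) s.
    if g x - y > \<epsilon>
    then s\<lparr>cuts := cuts s \<inter> halfspace_at g c x,
           under := (\<lambda>z. max (under s z) (affine_minorant g c x z))\<rparr>
    else s\<lparr>done_verts := insert (x, y) (done_verts s)\<rparr>)"

text \<open>One pass of the while loop, treating the vertices in the order given by the list.\<close>

definition while_pass ::
    "(real^'n \<Rightarrow> real) \<Rightarrow> (real^'n \<Rightarrow> real^'n) \<Rightarrow> real \<Rightarrow>
      ((real^'n) \<times> real) list \<Rightarrow> 'n alg_state \<Rightarrow> 'n alg_state"
  where "while_pass g c \<epsilon> vs s =
    (let s' = fold (treat_vertex g c \<epsilon>) vs (s\<lparr>cuts := UNIV\<rparr>)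
     in s'\<lparr>outer := outer s' \<inter> cuts s'\<rparr>)"

text \<open>\<open>alg_reaches g c l u \<epsilon> k s\<close>: some execution is in state \<open>s\<close> after \<open>k\<close> passes.  The
  execution is nondeterministic, since the for loop may enumerate the vertices in any order.\<close>

inductive alg_reaches ::
    "(real^'n \<Rightarrow> real) \<Rightarrow> (real^'n \<Rightarrow> real^'n) \<Rightarrow> real^'n \<Rightarrow> real^'n \<Rightarrow> real \<Rightarrow>
      nat \<Rightarrow> 'n alg_state \<Rightarrow> bool"
  for g c l u \<epsilon>
  where
    start: "alg_reaches g c l u \<epsilon> 0 (init_state g c l u)"
  | pass: "\<lbrakk>alg_reaches g c l u \<epsilon> k s; cuts s \<noteq> UNIV;
            distinct vs; set vs = vert (outer s) - done_verts s\<rbrakk>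
          \<Longrightarrow> alg_reaches g c l u \<epsilon> (Suc k) (while_pass g c \<epsilon> vs s)"

definition alg_returns ::
    "(real^'n \<Rightarrow> real) \<Rightarrow> (real^'n \<Rightarrow> real^'n) \<Rightarrow> real^'n \<Rightarrow> real^'n \<Rightarrow> real \<Rightarrow>
      (real^'n \<Rightarrow> real) \<Rightarrow> ((real^'n) \<times> real) set \<Rightarrow> bool"
  where "alg_returns g c l u \<epsilon> h W \<longleftrightarrow>
    (\<exists>k s. alg_reaches g c l u \<epsilon> k s \<and> cuts s = UNIV \<and> h = under s \<and> W = vert (outer s))"

end

theory Submission
  imports Defs
begin

text \<open>The state always describes a cutting-plane model of \<open>g\<close>: the epigraph of \<open>under\<close> is a finite
  intersection of supporting halfspaces of the epigraph of \<open>g\<close>, and \<open>outer\<close> is the part of that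
  epigraph above the box (\<open>pass_invariant_reaches\<close>).  Hence \<open>under\<close> is polyhedral convex, and
  it lies below \<open>g\<close>.

  For the error bound, note that every cut removes points from the space, so a pass that ends with
  \<open>cuts = UNIV\<close> has made no cut.  It has therefore left \<open>outer\<close> unchanged, and it has found error at
  most \<open>\<epsilon>\<close> at each vertex of \<open>outer\<close>, if an earlier pass had not already done so.  What remains is
  to pass from the vertices to all of \<open>outer\<close>, which is unbounded upwards.  Its part below a
  large height \<open>M\<close> is compact, so it is the convex hull of its extreme points.  These are
  vertices of \<open>outer\<close> or have height \<open>M\<close>; once \<open>M\<close> exceeds \<open>g\<close> on the box, both kinds
  lie in the convex set \<open>{(x, t). g x - t \<le> \<epsilon>}\<close>, and so does their convex hull
  (\<open>error_le_if_error_le_at_vertices\<close>).  Applied to the points \<open>(x, h x)\<close>, this is the bound.\<close>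

section \<open>From the vertices to the whole set\<close>

text \<open>A segment through a point strictly below the truncation height can be shrunk
  towards that point until it lies below that height as well.\<close>

lemma extreme_point_of_truncation:
  fixes C :: "('a::real_vector \<times> real) set"
  assumes "convex C" and "(x, t) extreme_point_of (C \<inter> UNIV \<times> {..M})" and "t < M"
  shows "(x, t) extreme_point_of C"
  unfolding extreme_point_of_def
proof (intro conjI ballI notI)
  show xt: "(x, t) \<in> C"
    using assms(2) by (auto simp: extreme_point_of_def)
  fix a b assume a: "a \<in> C" and b: "b \<in> C" and seg: "(x, t) \<in> open_segment a b"
  from seg obtain r where ab: "a \<noteq> b" and r: "0 < r" "r < 1" and p: "(x, t) = (1 - r) *\<^sub>R a + r *\<^sub>R b"
    by (auto simp: in_segment)
  \<comment> \<open>Contracting the segment towards \<open>(x, t)\<close> by the factor \<open>d\<close> raises no endpoint above \<open>M\<close>; the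
    summand \<open>1\<close> only keeps the denominator positive.\<close>
  define d where "d = min 1 ((M - t) / (1 + \<bar>snd a - t\<bar> + \<bar>snd b - t\<bar>))"
  have d: "0 < d" "d \<le> 1"
    using \<open>t < M\<close> by (auto simp: d_def intro!: divide_pos_pos)
  have "d * (1 + \<bar>snd a - t\<bar> + \<bar>snd b - t\<bar>) \<le> M - t"
  proof -
    have "d \<le> (M - t) / (1 + \<bar>snd a - t\<bar> + \<bar>snd b - t\<bar>)"
      by (simp add: d_def)
    then show ?thesis
      by (subst (asm) pos_le_divide_eq) auto
  qed
  moreover have "d * (snd a - t) \<le> d * (1 + \<bar>snd a - t\<bar> + \<bar>snd b - t\<bar>)"
    "d * (snd b - t) \<le> d * (1 + \<bar>snd a - t\<bar> + \<bar>snd b - t\<bar>)"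
    using d by (auto intro!: mult_left_mono)
  ultimately have low: "d * (snd a - t) \<le> M - t" "d * (snd b - t) \<le> M - t"
    by linarith+
  define a' b' where "a' = (1 - d) *\<^sub>R (x, t) + d *\<^sub>R a" and "b' = (1 - d) *\<^sub>R (x, t) + d *\<^sub>R b"
  have "a' \<in> C" "b' \<in> C"
    using assms(1) xt a b d unfolding a'_def b'_def by (auto intro!: convexD simp del: scaleR_Pair)
  moreover have "snd a' \<le> M" "snd b' \<le> M"
    using low by (auto simp: a'_def b'_def algebra_simps)
  ultimately have "a' \<in> C \<inter> UNIV \<times> {..M}" "b' \<in> C \<inter> UNIV \<times> {..M}"
    by (auto simp: mem_Times_iff)
  moreover have "(x, t) \<in> open_segment a' b'"
  proof -
    have "a' \<noteq> b'"
      using ab d by (simp add: a'_def b'_def)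
    moreover have "(x, t) = (1 - r) *\<^sub>R a' + r *\<^sub>R b'"
    proof -
      have "(1 - r) *\<^sub>R a' + r *\<^sub>R b' = (1 - d) *\<^sub>R (x, t) + d *\<^sub>R ((1 - r) *\<^sub>R a + r *\<^sub>R b)"
        unfolding a'_def b'_def by (simp add: algebra_simps del: scaleR_Pair)
      also have "\<dots> = (1 - d) *\<^sub>R (x, t) + d *\<^sub>R (x, t)"
        by (simp only: p)
      also have "\<dots> = (x, t)"
        by (simp add: algebra_simps)
      finally show ?thesis ..
    qed
    ultimately show ?thesis
      using r by (auto simp: in_segment)
  qed
  ultimately show False
    using assms(2) by (auto simp: extreme_point_of_def)
qed

text \<open>The bound \<open>m\<close> from below is essential: it makes the truncations of \<open>C\<close> compact, so that
  Krein--Milman applies and no recession directions have to be considered.  Truncation introduces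
  new extreme points only at the top, where \<open>g x - t\<close> is at most \<open>0\<close>.\<close>

lemma error_le_if_error_le_at_vertices:
  fixes g :: "'a::euclidean_space \<Rightarrow> real"
  assumes g: "convex_on UNIV g" and "0 \<le> \<epsilon>"
    and "compact X" and C: "closed C" "convex C" "C \<subseteq> X \<times> {m..}"
    and verts: "\<And>x y. (x, y) \<in> vert C \<Longrightarrow> g x - y \<le> \<epsilon>"
    and "(x, t) \<in> C"
  shows "g x - t \<le> \<epsilon>"
proof -
  have "continuous_on UNIV g"
    using g by (intro convex_on_continuous) auto
  then have "bounded (g ` X)"
    using \<open>compact X\<close> by (meson compact_continuous_image compact_imp_bounded continuous_on_subset subset_UNIV)
  then obtain B where B: "\<And>z. z \<in> X \<Longrightarrow> g z \<le> B"
    unfolding bounded_real by (meson abs_le_D1 imageI)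
  \<comment> \<open>High enough to keep the given point and to lie above \<open>g\<close> on \<open>X\<close>.\<close>
  define M where "M = max t B"
  define T where "T = C \<inter> UNIV \<times> {..M}"
  have "T = (X \<times> {m..M}) \<inter> (C \<inter> UNIV \<times> {..M})"
    using C(3) by (auto simp: T_def)
  moreover have "compact \<dots>"
    using \<open>compact X\<close> C(1) by (intro compact_Int_closed compact_Times closed_Int closed_Times) auto
  ultimately have "compact T" by simp
  moreover have "convex T"
    using C(2) unfolding T_def by (intro convex_Int convex_Times) auto
  ultimately have T: "T = convex hull {p. p extreme_point_of T}"
    by (rule Krein_Milman_Minkowski)
  let ?E = "epigraph UNIV (\<lambda>z. g z + - \<epsilon>)"
  have "convex_on UNIV (\<lambda>z. g z + - \<epsilon>)"
    using g by (intro convex_on_add) (auto simp: convex_on_const)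
  then have "convex ?E"
    by (simp add: convex_epigraph)
  moreover have "{p. p extreme_point_of T} \<subseteq> ?E"
  proof clarify
    fix z y assume ext: "(z, y) extreme_point_of T"
    then have zy: "(z, y) \<in> C" "y \<le> M"
      by (auto simp: extreme_point_of_def T_def)
    show "(z, y) \<in> ?E"
    proof (cases "y < M")
      case True
      then have "(z, y) \<in> vert C"
        using extreme_point_of_truncation C(2) ext by (auto simp: vert_def T_def)
      then show ?thesis
        using verts by (force simp: mem_epigraph)
    next
      case False
      moreover have "g z \<le> B"
        using B C(3) zy by auto
      ultimately show ?thesis
        using \<open>0 \<le> \<epsilon>\<close> by (auto simp: mem_epigraph M_def)
    qed
  qed
  ultimately have "T \<subseteq> ?E"
    using T by (metis hull_minimal)
  moreover have "(x, t) \<in> T"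
    using assms(8) by (simp add: T_def M_def)
  ultimately show ?thesis
    by (auto simp: mem_epigraph)
qed

section \<open>Cutting-plane models\<close>

text \<open>Stated through epigraphs, a pointwise maximum of affine minorants becomes an intersection
  of halfspaces, which is the form in which \<open>outer\<close> is updated.  One minorant at least is required
  so that \<open>h\<close> is bounded below on bounded sets.\<close>

definition cutting_plane_model ::
    "(real^'n \<Rightarrow> real) \<Rightarrow> (real^'n \<Rightarrow> real^'n) \<Rightarrow> (real^'n \<Rightarrow> real) \<Rightarrow> bool"
  where "cutting_plane_model g c h \<longleftrightarrow>
    (\<exists>Z. finite Z \<and> Z \<noteq> {} \<and> epigraph UNIV h = (\<Inter>z\<in>Z. halfspace_at g c z))"

lemma halfspace_at_eq_epigraph: "halfspace_at g c z = epigraph UNIV (affine_minorant g c z)"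
  by (auto simp: halfspace_at_def affine_minorant_def mem_epigraph inner_diff_right)

lemma halfspace_at_neq_UNIV: "halfspace_at g c z \<noteq> UNIV"
proof -
  have "(z, g z - 1) \<notin> halfspace_at g c z"
    by (simp add: halfspace_at_def)
  then show ?thesis by blast
qed

lemma polyhedron_halfspace_at: "polyhedron (halfspace_at g c z)"
proof -
  have "halfspace_at g c z = {p. (- c z, 1) \<bullet> p \<ge> g z - c z \<bullet> z}"
    by (auto simp: halfspace_at_def)
  then show ?thesis
    by (metis polyhedron_halfspace_ge)
qed

lemma cutting_plane_model_affine_minorant: "cutting_plane_model g c (affine_minorant g c z)"
  unfolding cutting_plane_model_def halfspace_at_eq_epigraph by (intro exI[of _ "{z}"]) auto

lemma epigraph_max:
  "epigraph UNIV (\<lambda>x. max (f x) (h x)) = epigraph UNIV f \<inter> epigraph UNIV h"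
  by (auto simp: mem_epigraph)

lemma cutting_plane_model_max:
  assumes "cutting_plane_model g c h"
  shows "cutting_plane_model g c (\<lambda>x. max (h x) (affine_minorant g c z x))"
proof -
  from assms obtain Z where "finite Z" "Z \<noteq> {}" "epigraph UNIV h = (\<Inter>w\<in>Z. halfspace_at g c w)"
    by (auto simp: cutting_plane_model_def)
  then show ?thesis
    unfolding cutting_plane_model_def epigraph_max halfspace_at_eq_epigraph[symmetric]
    by (intro exI[of _ "insert z Z"]) auto
qed

lemma cutting_plane_model_polyhedral:
  assumes "cutting_plane_model g c h"
  shows "polyhedron (epigraph UNIV h)"
  using assms by (auto simp: cutting_plane_model_def intro!: polyhedron_Inter polyhedron_halfspace_at)

lemma cutting_plane_model_le:
  assumes "cutting_plane_model g c h" and "\<And>z. c z \<in> subdifferential g z"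
  shows "h x \<le> g x"
proof -
  have "(x, g x) \<in> halfspace_at g c z" for z
    using assms(2)[of z] by (auto simp: halfspace_at_def subdifferential_def inner_diff_right algebra_simps)
  then have "(x, g x) \<in> epigraph UNIV h"
    using assms(1) by (auto simp: cutting_plane_model_def)
  then show ?thesis
    by (simp add: mem_epigraph)
qed

lemma cutting_plane_model_bounded_below:
  assumes "cutting_plane_model g c h" and "compact X"
  obtains m where "epigraph UNIV h \<inter> X \<times> UNIV \<subseteq> X \<times> {m..}"
proof -
  from assms(1) obtain z where z: "epigraph UNIV h \<subseteq> halfspace_at g c z"
    by (auto simp: cutting_plane_model_def)
  have "bounded (affine_minorant g c z ` X)"
    unfolding affine_minorant_def
    by (intro compact_imp_bounded compact_continuous_image assms continuous_intros)
  then obtain B where B: "\<And>x. x \<in> X \<Longrightarrow> \<bar>affine_minorant g c z x\<bar> \<le> B"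
    by (auto simp: bounded_real)
  show ?thesis
  proof (intro that[of "- B"] subrelI)
    fix x t assume "(x, t) \<in> epigraph UNIV h \<inter> X \<times> UNIV"
    then have "x \<in> X" "(x, t) \<in> epigraph UNIV h"
      by auto
    then have "affine_minorant g c z x \<le> t"
      using subsetD[OF z] by (force simp: halfspace_at_eq_epigraph mem_epigraph)
    then show "(x, t) \<in> X \<times> {- B..}"
      using B[OF \<open>x \<in> X\<close>] \<open>x \<in> X\<close> by auto
  qed
qed

section \<open>Invariants of the algorithm\<close>

text \<open>During a pass \<open>outer\<close> lags behind \<open>under\<close>, since the new cuts are applied to it only at the
  end; therefore \<open>outer \<inter> cuts\<close> is compared with the epigraph.\<close>

definition loop_invariant ::
    "(real^'n \<Rightarrow> real) \<Rightarrow> (real^'n \<Rightarrow> real^'n) \<Rightarrow> real \<Rightarrow> (real^'n) set \<Rightarrow> 'n alg_state \<Rightarrow> bool"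
  where "loop_invariant g c \<epsilon> X s \<longleftrightarrow>
    cutting_plane_model g c (under s) \<and>
    outer s \<inter> cuts s = epigraph UNIV (under s) \<inter> X \<times> UNIV \<and>
    (\<forall>(x, y)\<in>done_verts s. g x - y \<le> \<epsilon>)"

lemma loop_invariant_fold_treat_vertex:
  assumes "loop_invariant g c \<epsilon> X s"
  shows "loop_invariant g c \<epsilon> X (fold (treat_vertex g c \<epsilon>) vs s)"
proof -
  have "loop_invariant g c \<epsilon> X (treat_vertex g c \<epsilon> v s')" if "loop_invariant g c \<epsilon> X s'" for v s'
    using that unfolding loop_invariant_def treat_vertex_def
    by (auto simp: cutting_plane_model_max epigraph_max halfspace_at_eq_epigraph split: prod.splits)
  then show ?thesis
    using assms by (induction vs arbitrary: s) auto
qed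

lemma outer_fold_treat_vertex: "outer (fold (treat_vertex g c \<epsilon>) vs s) = outer s"
  by (induction vs arbitrary: s) (auto simp: treat_vertex_def split: prod.splits)

lemma done_verts_fold_treat_vertex_mono:
  "done_verts s \<subseteq> done_verts (fold (treat_vertex g c \<epsilon>) vs s)"
proof (induction vs arbitrary: s)
  case (Cons v vs)
  have "done_verts s \<subseteq> done_verts (treat_vertex g c \<epsilon> v s)"
    by (auto simp: treat_vertex_def split: prod.splits)
  with Cons show ?case
    by fastforce
qed simp

lemma cuts_fold_treat_vertex_antimono:
  "cuts (fold (treat_vertex g c \<epsilon>) vs s) \<subseteq> cuts s"
proof (induction vs arbitrary: s)
  case (Cons v vs)
  have "cuts (treat_vertex g c \<epsilon> v s) \<subseteq> cuts s"
    by (auto simp: treat_vertex_def split: prod.splits)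
  with Cons show ?case
    by fastforce
qed simp

text \<open>A vertex that is not accepted adds a proper halfspace to \<open>cuts\<close>, which then
  stays different from \<open>UNIV\<close>.\<close>

lemma done_verts_if_no_cut:
  assumes "cuts (fold (treat_vertex g c \<epsilon>) vs s) = UNIV"
  shows "set vs \<subseteq> done_verts (fold (treat_vertex g c \<epsilon>) vs s)"
  using assms
proof (induction vs arbitrary: s)
  case (Cons v vs)
  let ?s = "treat_vertex g c \<epsilon> v s"
  have "cuts ?s = UNIV"
    using cuts_fold_treat_vertex_antimono[of g c \<epsilon> vs ?s] Cons.prems by auto
  then have "v \<in> done_verts ?s"
    using halfspace_at_neq_UNIV
    by (auto simp: treat_vertex_def Int_UNIV split: prod.splits if_splits)
  then have "v \<in> done_verts (fold (treat_vertex g c \<epsilon>) vs ?s)"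
    using done_verts_fold_treat_vertex_mono by blast
  with Cons show ?case by auto
qed simp

text \<open>The last conjunct is the stopping criterion at work.  It holds vacuously at the start, where
  \<open>cuts\<close> is empty, and after a pass with cuts; after a pass without cuts the vertices that were
  treated are still the vertices of \<open>outer\<close>.\<close>

definition pass_invariant ::
    "(real^'n \<Rightarrow> real) \<Rightarrow> (real^'n \<Rightarrow> real^'n) \<Rightarrow> real \<Rightarrow> (real^'n) set \<Rightarrow> 'n alg_state \<Rightarrow> bool"
  where "pass_invariant g c \<epsilon> X s \<longleftrightarrow>
    cutting_plane_model g c (under s) \<and>
    outer s = epigraph UNIV (under s) \<inter> X \<times> UNIV \<and>
    (\<forall>(x, y)\<in>done_verts s. g x - y \<le> \<epsilon>) \<and>
    (cuts s = UNIV \<longrightarrow> vert (outer s) \<subseteq> done_verts s)"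

lemma pass_invariant_while_pass:
  assumes "pass_invariant g c \<epsilon> X s" and "set vs = vert (outer s) - done_verts s"
  shows "pass_invariant g c \<epsilon> X (while_pass g c \<epsilon> vs s)"
proof -
  let ?s = "s\<lparr>cuts := UNIV\<rparr>"
  let ?s' = "fold (treat_vertex g c \<epsilon>) vs ?s"
  have "loop_invariant g c \<epsilon> X ?s"
    using assms(1) by (simp add: loop_invariant_def pass_invariant_def)
  then have inv: "loop_invariant g c \<epsilon> X ?s'"
    by (rule loop_invariant_fold_treat_vertex)
  have "vert (outer ?s') \<subseteq> done_verts ?s'" if "cuts ?s' = UNIV"
    using done_verts_if_no_cut[OF that] done_verts_fold_treat_vertex_mono[of ?s g c \<epsilon> vs] assms(2)
    by (auto simp: outer_fold_treat_vertex)
  with inv show ?thesis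
    by (auto simp: while_pass_def Let_def pass_invariant_def loop_invariant_def)
qed

lemma pass_invariant_reaches:
  assumes "alg_reaches g c l u \<epsilon> k s"
  shows "pass_invariant g c \<epsilon> (cbox l u) s"
  using assms
proof induction
  case start
  show ?case
    by (auto simp: pass_invariant_def init_state_def cutting_plane_model_affine_minorant
        halfspace_at_eq_epigraph)
next
  case pass
  then show ?case
    by (simp add: pass_invariant_while_pass)
qed

section \<open>Correctness of the algorithm\<close>

theorem theorem3p10:
  fixes l u :: "real^'n" and g h :: "real^'n \<Rightarrow> real" and c :: "real^'n \<Rightarrow> real^'n"
    and \<epsilon> :: real and W :: "((real^'n) \<times> real) set"
  assumes "\<And>i. l $ i < u $ i"
    and "convex_on UNIV g"
    and "\<epsilon> > 0"
    and "\<And>x. c x \<in> subdifferential g x"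
    and "alg_returns g c l u \<epsilon> h W"
  shows "polyhedral_underestimator \<epsilon> (cbox l u) g h"
proof -
  from assms(5) obtain k s where "alg_reaches g c l u \<epsilon> k s" and s: "cuts s = UNIV" "h = under s"
    by (auto simp: alg_returns_def)
  then have inv: "pass_invariant g c \<epsilon> (cbox l u) s"
    using pass_invariant_reaches by blast
  then have model: "cutting_plane_model g c h"
    and outer: "outer s = epigraph UNIV h \<inter> cbox l u \<times> UNIV"
    and verts: "\<And>x y. (x, y) \<in> vert (outer s) \<Longrightarrow> g x - y \<le> \<epsilon>"
    using s by (auto simp: pass_invariant_def)
  have poly: "polyhedron (epigraph UNIV h)"
    using model by (rule cutting_plane_model_polyhedral)
  have C: "closed (outer s)" "convex (outer s)"
    unfolding outer
    by (intro closed_Int convex_Int closed_Times convex_Times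
        polyhedron_imp_closed[OF poly] polyhedron_imp_convex[OF poly] closed_cbox convex_box
        closed_UNIV convex_UNIV)+
  obtain m where "outer s \<subseteq> cbox l u \<times> {m..}"
    using cutting_plane_model_bounded_below[OF model compact_cbox] unfolding outer .
  then have "g x - h x \<le> \<epsilon>" if "x \<in> cbox l u" for x
    using error_le_if_error_le_at_vertices[OF assms(2) less_imp_le[OF assms(3)] compact_cbox C _ verts] that
    by (auto simp: outer mem_epigraph)
  then show ?thesis
    using poly cutting_plane_model_le[OF model assms(4)]
    by (auto simp: polyhedral_underestimator_def polyhedral_convex_fun_def)
qed

end
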